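(* Consider the $2$-vertex directed graph IFS on the unit interval described in the context, with attractors $F_u,F_v$; let $s=\dim_{\rm H}F_u=\dim_{\rm H}F_v$, $h_u=\mathcal{H}^s(F_u)$, $h_v=\mathcal{H}^s(F_v)$. Suppose that $$(1)\ |I_u|=|I_v|\ (\text{which holds automatically here, both being } 1),\qquad (2)\ \frac{h_v}{h_u}\leq 1,\qquad (3)\ \frac{(a+g_u)(1-a^s)}{b\,a^s}\geq 1$$ (so that $\mathcal{H}^s(F_u)=|I_u|^s=1$), and suppose that the set $\{g_u,g_v,a,b,c,d\}\subset\mathbb{R}^+$ is multiplicatively rationally independent. Then $F_u$ is not the attractor of any standard ($1$-vertex) IFS defined on $\mathbb{R}$, with or without separation conditions.
   Context: The $2$-vertex IFS on the unit interval: $I_u=I_v=[0,1]$, and $a,g_u,b,c,g_v,d>0$ satisfy $a+g_u+b=1$ and $c+g_v+d=1$. Define $S_{e_1}(x)=ax$, $S_{e_2}(x)=bx+a+g_u$, $S_{e_3}(x)=cx$, $S_{e_4}(x)=dx+c+g_v$ on $\mathbb{R}$. The attractors are the unique non-empty compact sets $F_u,F_v\subset\mathbb{R}$ with $F_u=S_{e_1}(F_u)\cup S_{e_2}(F_v)$ and $F_v=S_{e_3}(F_v)\cup S_{e_4}(F_u)$. (Known: $s$ is the unique non-negative real for which the matrix with rows $(a^s,b^s)$ and $(d^s,c^s)$ has spectral radius $1$, and $0<\mathcal{H}^s(F_u),\mathcal{H}^s(F_v)<+\infty$.) $\mathcal{H}^s$ is Hausdorff measure normalised using $\sum_i|U_i|^s$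 over covers, with no additional constant. Multiplicatively rationally independent: a set $\{u_1,\dots,u_r\}$ of positive reals (listed as displayed) is multiplicatively rationally independent if for all integers $m_1,\dots,m_r$, $\prod_{i=1}^r u_i^{m_i}=1$ implies $m_i=0$ for all $i$. In particular the listed numbers are distinct. Standard ($1$-vertex) IFS on $\mathbb{R}$: a finite family $S_1,\dots,S_n$, $n\geq2$, of contracting similarities $S_i:\mathbb{R}\to\mathbb{R}$ (ratios in $(0,1)$, orientation reversal allowed); its attractor is the unique non-empty compact $F\subset\mathbb{R}$ with $F=\bigcup_{i=1}^nS_i(F)$. "With or without separation conditions" means no condition whatsoever is imposed on overlaps of the sets $S_i(F)$. *)

theory Defs
  imports "HOL-Analysis.Analysis"
begin

text \<open>
  The term $|U|^s$ of a cover, with the conventions $|\emptyset|^s = 0$ and $|U|^0 = 1$ for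
  nonempty \<open>U\<close>.  The case \<open>s = 0\<close> is separate because \<^term>\<open>0 powr 0 = (0::real)\<close>.
\<close>

definition diam_powr :: "real \<Rightarrow> 'a::metric_space set \<Rightarrow> ennreal" where
  "diam_powr s U =
     (if U = {} then 0 else if s = 0 then 1 else ennreal (diameter U powr s))"

text \<open>
  Covers are sequences of sets; finite covers are padded with the empty set.  Boundedness is
  required explicitly because \<^const>\<open>diameter\<close> is meaningless on unbounded sets.
\<close>

definition delta_covers :: "real \<Rightarrow> 'a::metric_space set \<Rightarrow> (nat \<Rightarrow> 'a set) set" where
  "delta_covers \<delta> A =
     {U. A \<subseteq> (\<Union>i. U i) \<and> (\<forall>i. bounded (U i) \<and> diameter (U i) \<le> \<delta>)}"

definition hausdorff_content :: "real \<Rightarrow> real \<Rightarrow> 'a::metric_space set \<Rightarrow> ennreal" where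
  "hausdorff_content \<delta> s A = (INF U\<in>delta_covers \<delta> A. \<Sum>i. diam_powr s (U i))"

definition hausdorff_measure :: "real \<Rightarrow> 'a::metric_space set \<Rightarrow> ennreal" where
  "hausdorff_measure s A = (SUP \<delta>\<in>{0<..}. hausdorff_content \<delta> s A)"

text \<open>
  In Euclidean space the set below is never empty, so the infimum can be taken in the reals.
\<close>

definition hausdorff_dim :: "'a::euclidean_space set \<Rightarrow> real" where
  "hausdorff_dim A = Inf {s. 0 \<le> s \<and> hausdorff_measure s A = 0}"

text \<open>
  The pair \<open>(F\<^sub>u, F\<^sub>v)\<close> of nonempty compact sets solving these equations is unique, so this
  predicate determines the attractors; the same remark applies to \<open>ifs_attractor\<close> below.
\<close>

definition two_vertex_attractors ::
  "real \<Rightarrow> real \<Rightarrow> real \<Rightarrow> real \<Rightarrow> real \<Rightarrow> real \<Rightarrow> real set \<Rightarrow> real set \<Rightarrow> bool" where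
  "two_vertex_attractors a g_u b c g_v d F_u F_v \<longleftrightarrow>
     compact F_u \<and> F_u \<noteq> {} \<and> compact F_v \<and> F_v \<noteq> {} \<and>
     F_u = (\<lambda>x. a * x) ` F_u \<union> (\<lambda>x. b * x + a + g_u) ` F_v \<and>
     F_v = (\<lambda>x. c * x) ` F_v \<union> (\<lambda>x. d * x + c + g_v) ` F_u"

text \<open>
  A list is used instead of a set so that repeated entries count separately.
\<close>

definition mult_rat_indep :: "real list \<Rightarrow> bool" where
  "mult_rat_indep us \<longleftrightarrow>
     (\<forall>u\<in>set us. 0 < u) \<and>
     (\<forall>m :: nat \<Rightarrow> int. (\<Prod>i<length us. (us ! i) powi (m i)) = 1 \<longrightarrow> (\<forall>i<length us. m i = 0))"

definition contracting_similarity :: "(real \<Rightarrow> real) \<Rightarrow> bool" where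
  "contracting_similarity f \<longleftrightarrow>
     (\<exists>r. 0 < r \<and> r < 1 \<and> (\<forall>x y. \<bar>f x - f y\<bar> = r * \<bar>x - y\<bar>))"

definition standard_ifs :: "nat \<Rightarrow> (nat \<Rightarrow> real \<Rightarrow> real) \<Rightarrow> bool" where
  "standard_ifs n S \<longleftrightarrow> 2 \<le> n \<and> (\<forall>i<n. contracting_similarity (S i))"

definition ifs_attractor :: "nat \<Rightarrow> (nat \<Rightarrow> real \<Rightarrow> real) \<Rightarrow> real set \<Rightarrow> bool" where
  "ifs_attractor n S F \<longleftrightarrow> compact F \<and> F \<noteq> {} \<and> F = (\<Union>i<n. S i ` F)"

end

theory Submission
  imports Defs
begin

text \<open>
  The proof looks at one point, the right endpoint \<open>q = a + g\<^sub>u\<close> of the first-level gap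
  \<open>(a, a + g\<^sub>u)\<close> of \<open>F\<^sub>u\<close>, and at the scaling behaviour of \<open>F\<^sub>u\<close> there.

  Just to the right of \<open>q\<close> the set \<open>F\<^sub>u\<close> is a copy of \<open>F\<^sub>v\<close> near \<open>0\<close>. For every \<open>m\<close> the
  interval \<open>(c\<^sup>m\<^sup>+\<^sup>1, c\<^sup>m (c + g\<^sub>v))\<close> misses \<open>F\<^sub>v\<close>. On the logarithmic scale
  these holes are a periodic pattern of intervals with period \<open>ln c\<close>, so by Kronecker's theorem they
  are hit by every sequence \<open>\<mu> t\<^sup>n\<close> in \<open>(0, 1]\<close> with \<open>ln t / ln c\<close> irrational
  (lemma \<open>geometric_sequence_hits_scaled_interval\<close>). Multiplicative independence makes \<open>ln a / ln c\<close>
  and \<open>ln (b d) / ln c\<close> irrational. Hence, for \<open>\<kappa> > 0\<close>, neither \<open>q + \<kappa> a\<^sup>n\<close> nor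
  \<open>q + \<kappa> (b d)\<^sup>n\<close> stays in \<open>F\<^sub>u\<close> (lemma \<open>no_geometric_sequence_right_of_gap\<close>).

  Suppose \<open>F\<^sub>u\<close> were the attractor of a standard IFS. Then \<open>q = S x\<close> for some map \<open>S\<close> of it, of ratio
  \<open>r < 1\<close>, and some \<open>x\<close> in \<open>F\<^sub>u\<close>. Since \<open>S\<close> maps \<open>F\<^sub>u\<close> into \<open>F\<^sub>u\<close>, the gap to the left of \<open>q\<close>
  pulls back to an interval of length \<open>g\<^sub>u / r > g\<^sub>u\<close> that has \<open>x\<close> as an endpoint and misses \<open>F\<^sub>u\<close>.
  What \<open>F\<^sub>u\<close> looks like on the other side of \<open>x\<close> is then known.

  If \<open>S\<close> preserves orientation, the interval lies to the left of \<open>x\<close>. So \<open>x\<close> is \<open>0\<close> or the right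
  endpoint of a gap. That gap is a scaled copy of \<open>(a, a + g\<^sub>u)\<close> or of \<open>(c, c + g\<^sub>v)\<close>, and the
  former are too short because all scaling factors are at most \<open>1\<close>. In the remaining cases \<open>F\<^sub>u\<close> to
  the right of \<open>x\<close> is a copy of \<open>F\<^sub>u\<close> near \<open>0\<close>, which contains the sequence \<open>a\<^sup>n\<close>
  (lemma \<open>left_isolated\<close>).

  If \<open>S\<close> reverses orientation, the interval lies to the right of \<open>x\<close>. Then \<open>F\<^sub>u\<close> to the left of \<open>x\<close>
  is a copy of \<open>F\<^sub>u\<close> or \<open>F\<^sub>v\<close> near \<open>1\<close>, and both contain a sequence \<open>1 - \<kappa> (b d)\<^sup>n\<close>
  (lemma \<open>right_isolated\<close>).

  In either case \<open>S\<close> carries the geometric sequence at \<open>x\<close> to a forbidden one to the right of \<open>q\<close>.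
  The contradiction comes from a single map of the standard IFS, so overlaps between the pieces are
  harmless.
\<close>

section \<open>Irrational logarithmic ratios and dense geometric sequences\<close>

lemma rational_ln_ratio_imp_powi_eq:
  fixes t c :: real
  assumes "0 < t" "0 < c" "c < 1" "ln t / ln c \<in> \<rat>"
  shows "\<exists>p q :: int. q \<noteq> 0 \<and> t powi q = c powi p"
proof -
  obtain p q :: int where "q > 0" and pq: "ln t / ln c = of_int p / of_int q"
    using assms(4) by (meson Rats_cases')
  have "ln c \<noteq> 0" using assms by simp
  with pq \<open>q > 0\<close> have "of_int q * ln t = of_int p * ln c"
    by (simp add: field_simps)
  hence "exp (of_int q * ln t) = exp (of_int p * ln c)" by simp
  hence "t powr of_int q = c powr of_int p" using assms by (simp add: powr_def)
  hence "t powi q = c powi p" using assms by (simp add: powr_real_of_int')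
  with \<open>q > 0\<close> show ?thesis by (intro exI[of _ p] exI[of _ q]) auto
qed

text \<open>
  In the coordinate \<open>ln x / ln c\<close> the interval for \<open>m\<close> is \<open>(m + \<delta>, m + 1)\<close> with
  \<open>\<delta> = ln e / ln c < 1\<close>, and the sequence is an arithmetic progression with irrational step; density
  modulo \<open>1\<close> is Kronecker's theorem. The bound \<open>\<mu> \<le> 1\<close> makes the integer part \<open>m\<close> nonnegative.
\<close>

lemma geometric_sequence_hits_scaled_interval:
  fixes t c e \<mu> :: real
  assumes "0 < t" "t < 1" "0 < c" "c < e" "e < 1" "0 < \<mu>" "\<mu> \<le> 1"
    and irr: "ln t / ln c \<notin> \<rat>"
  obtains m n :: nat where "c ^ Suc m < \<mu> * t ^ n" "\<mu> * t ^ n < c ^ m * e"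
proof -
  define \<theta> \<beta> \<delta> where "\<theta> = ln t / ln c" and "\<beta> = ln \<mu> / ln c" and "\<delta> = ln e / ln c"
  have lnc: "ln c < 0" and lnt: "ln t < 0" and "ln \<mu> \<le> 0"
    using assms by (auto simp: ln_less_zero)
  have "\<theta> > 0" "\<beta> \<ge> 0"
    using lnc lnt \<open>ln \<mu> \<le> 0\<close> by (auto simp: \<theta>_def \<beta>_def divide_neg_neg divide_nonpos_neg)
  have "\<delta> < 1"
    using assms lnc by (simp add: \<delta>_def divide_less_eq)
  hence "(1 - \<delta>) / 2 > 0" by simp
  then obtain h k :: int where "k > 0"
    and "\<bar>of_int k * \<theta> - of_int h - ((1 + \<delta>) / 2 - \<beta>)\<bar> < (1 - \<delta>) / 2"
    using sequence_of_fractional_parts_is_dense[of \<theta> "(1 - \<delta>) / 2" "(1 + \<delta>) / 2 - \<beta>"] irr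
    unfolding \<theta>_def by blast
  hence lo: "of_int h + \<delta> < \<beta> + of_int k * \<theta>" and hi: "\<beta> + of_int k * \<theta> < of_int h + 1"
    unfolding abs_less_iff by (simp_all add: field_simps)
  have "0 < \<beta> + of_int k * \<theta>"
    using \<open>k > 0\<close> \<open>\<theta> > 0\<close> \<open>\<beta> \<ge> 0\<close> by (simp add: add_nonneg_pos)
  with hi have "real_of_int (- 1) < of_int h" by simp
  hence "h \<ge> 0" unfolding of_int_less_iff by simp
  define m n where "m = nat h" and "n = nat k"
  have mn: "of_int h = real m" "of_int k = real n"
    using \<open>h \<ge> 0\<close> \<open>k > 0\<close> by (auto simp: m_def n_def)
  have eq: "(\<beta> + real n * \<theta>) * ln c = ln (\<mu> * t ^ n)"
    using lnc assms by (simp add: \<beta>_def \<theta>_def ln_mult ln_realpow field_simps)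
  have "ln (\<mu> * t ^ n) > (real m + 1) * ln c"
    using mult_strict_right_mono_neg[OF hi lnc] eq mn by simp
  also have "(real m + 1) * ln c = ln (c ^ Suc m)"
    using assms ln_realpow[of c "Suc m"] by (simp add: add.commute)
  finally have 1: "c ^ Suc m < \<mu> * t ^ n"
    using assms by (subst (asm) ln_less_cancel_iff) auto
  have "ln (\<mu> * t ^ n) < (real m + \<delta>) * ln c"
    using mult_strict_right_mono_neg[OF lo lnc] eq mn by simp
  also have "(real m + \<delta>) * ln c = ln (c ^ m * e)"
    using assms lnc by (simp add: \<delta>_def ln_mult ln_realpow field_simps)
  finally have 2: "\<mu> * t ^ n < c ^ m * e"
    using assms by (subst (asm) ln_less_cancel_iff) auto
  from 1 2 that show ?thesis by blast
qed

section \<open>Similarities of the line\<close>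

lemma contracting_similarity_affine:
  assumes "contracting_similarity f"
  obtains r \<epsilon> :: real where "0 < r" "r < 1" "\<epsilon> = 1 \<or> \<epsilon> = - 1" "\<And>x y. f y = f x + \<epsilon> * r * (y - x)"
proof -
  obtain r where r: "0 < r" "r < 1" and f: "\<And>x y. \<bar>f x - f y\<bar> = r * \<bar>x - y\<bar>"
    using assms unfolding contracting_similarity_def by blast
  define \<epsilon> where "\<epsilon> = (f 1 - f 0) / r"
  have \<epsilon>: "\<epsilon> = 1 \<or> \<epsilon> = - 1"
    using f[of 1 0] r by (auto simp: \<epsilon>_def abs_if field_simps split: if_splits)
  have lin: "f y = f 0 + \<epsilon> * r * y" for y
  proof -
    have f1: "f 1 = f 0 + \<epsilon> * r" using r by (simp add: \<epsilon>_def)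
    \<comment> \<open>The distances to \<open>f 0\<close> and to \<open>f 1\<close> determine \<open>f y\<close>: compare the squares.\<close>
    have "(f y - f 0)\<^sup>2 = (r * y)\<^sup>2" "(f y - f 1)\<^sup>2 = (r * (y - 1))\<^sup>2"
      using arg_cong[OF f[of y 0], of "\<lambda>z. z\<^sup>2"] arg_cong[OF f[of y 1], of "\<lambda>z. z\<^sup>2"]
      by (simp_all add: power_mult_distrib)
    moreover have "\<epsilon>\<^sup>2 = 1" using \<epsilon> by auto
    ultimately have "2 * r * (\<epsilon> * (f y - f 0) - r * y) = 0"
      unfolding f1 by algebra
    hence "\<epsilon> * (f y - f 0) = r * y" using r by simp
    with \<epsilon> show ?thesis by auto
  qed
  have "f y = f x + \<epsilon> * r * (y - x)" for x y
    unfolding lin[of x] lin[of y] by (simp add: algebra_simps)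
  with r \<epsilon> that show ?thesis by blast
qed

section \<open>The two-vertex system on the unit interval\<close>

locale two_vertex_system =
  fixes a g_u b c g_v d :: real and F_u F_v :: "real set"
  assumes pos: "a > 0" "g_u > 0" "b > 0" "c > 0" "g_v > 0" "d > 0"
    and sum_u: "a + g_u + b = 1" and sum_v: "c + g_v + d = 1"
    and attractors: "two_vertex_attractors a g_u b c g_v d F_u F_v"
begin

lemma less_one: "a < 1" "b < 1" "c < 1" "d < 1"
  using pos sum_u sum_v by auto

lemma compact: "compact F_u" "compact F_v" and nonempty: "F_u \<noteq> {}" "F_v \<noteq> {}"
  using attractors by (auto simp: two_vertex_attractors_def)

lemma mem_u_iff:
  "x \<in> F_u \<longleftrightarrow> (\<exists>y\<in>F_u. x = a * y) \<or> (\<exists>y\<in>F_v. x = a + g_u + b * y)"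
proof -
  have "F_u = (\<lambda>x. a * x) ` F_u \<union> (\<lambda>x. b * x + a + g_u) ` F_v"
    using attractors by (simp add: two_vertex_attractors_def)
  from arg_cong[OF this, of "\<lambda>A. x \<in> A"] show ?thesis
    by (auto simp: image_iff algebra_simps)
qed

lemma mem_v_iff:
  "x \<in> F_v \<longleftrightarrow> (\<exists>y\<in>F_v. x = c * y) \<or> (\<exists>y\<in>F_u. x = c + g_v + d * y)"
proof -
  have "F_v = (\<lambda>x. c * x) ` F_v \<union> (\<lambda>x. d * x + c + g_v) ` F_u"
    using attractors by (simp add: two_vertex_attractors_def)
  from arg_cong[OF this, of "\<lambda>A. x \<in> A"] show ?thesis
    by (auto simp: image_iff algebra_simps)
qed

lemma map_a: "x \<in> F_u \<Longrightarrow> a * x \<in> F_u"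
  and map_b: "y \<in> F_v \<Longrightarrow> a + g_u + b * y \<in> F_u"
  and map_c: "y \<in> F_v \<Longrightarrow> c * y \<in> F_v"
  and map_d: "x \<in> F_u \<Longrightarrow> c + g_v + d * x \<in> F_v"
  using mem_u_iff mem_v_iff by blast+

lemma F_nonneg: assumes "x \<in> F_u \<union> F_v" shows "0 \<le> x"
proof -
  obtain m where m: "m \<in> F_u \<union> F_v" and min: "\<And>y. y \<in> F_u \<union> F_v \<Longrightarrow> m \<le> y"
    using compact_attains_inf[of "F_u \<union> F_v"] compact nonempty by blast
  have "0 \<le> m"
  proof (rule ccontr)
    assume "\<not> 0 \<le> m"
    \<comment> \<open>All four maps would send every point that is at least \<open>m\<close> strictly to the right of \<open>m\<close>.\<close>
    have scale: "m < k * y" if "0 < k" "k < 1" "m \<le> y" for k y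
    proof -
      have "m < k * m" using that \<open>\<not> 0 \<le> m\<close> by simp
      also have "k * m \<le> k * y" using that by simp
      finally show ?thesis .
    qed
    from m consider (a) y where "y \<in> F_u" "m = a * y" | (b) y where "y \<in> F_v" "m = a + g_u + b * y"
      | (c) y where "y \<in> F_v" "m = c * y" | (d) y where "y \<in> F_u" "m = c + g_v + d * y"
      using mem_u_iff[of m] mem_v_iff[of m] by (metis UnE)
    thus False
    proof cases
      case a thus ?thesis using scale[of a y] min[of y] pos less_one by auto
    next
      case b thus ?thesis using scale[of b y] min[of y] pos less_one by auto
    next
      case c thus ?thesis using scale[of c y] min[of y] pos less_one by auto
    next
      case d thus ?thesis using scale[of d y] min[of y] pos less_one by auto
    qed
  qed
  with min[OF assms] show ?thesis by simp
qed

lemma F_le_one: assumes "x \<in> F_u \<union> F_v" shows "x \<le> 1"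
proof -
  obtain m where m: "m \<in> F_u \<union> F_v" and max: "\<And>y. y \<in> F_u \<union> F_v \<Longrightarrow> y \<le> m"
    using compact_attains_sup[of "F_u \<union> F_v"] compact nonempty by blast
  have "m \<le> 1"
  proof (rule ccontr)
    assume "\<not> m \<le> 1"
    \<comment> \<open>Mirror image of the lower bound: the contraction \<open>y \<mapsto> 1 - k + k y\<close> fixes \<open>1\<close>, and every
      map of ratio \<open>k\<close> in the system lies at or below it.\<close>
    have scale: "1 - k + k * y < m" if "0 < k" "k < 1" "y \<le> m" for k y
    proof -
      have "k * y \<le> k * m" using that by simp
      moreover have "(1 - k) * 1 < (1 - k) * m" using that \<open>\<not> m \<le> 1\<close> by (intro mult_strict_left_mono) auto
      ultimately show ?thesis by (simp add: algebra_simps)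
    qed
    from m consider (a) y where "y \<in> F_u" "m = a * y" | (b) y where "y \<in> F_v" "m = a + g_u + b * y"
      | (c) y where "y \<in> F_v" "m = c * y" | (d) y where "y \<in> F_u" "m = c + g_v + d * y"
      using mem_u_iff[of m] mem_v_iff[of m] by (metis UnE)
    thus False
    proof cases
      case a thus ?thesis using scale[of a y] max[of y] pos less_one by auto
    next
      case b thus ?thesis using scale[of b y] max[of y] pos less_one sum_u by auto
    next
      case c thus ?thesis using scale[of c y] max[of y] pos less_one by auto
    next
      case d thus ?thesis using scale[of d y] max[of y] pos less_one sum_v by auto
    qed
  qed
  with max[OF assms] show ?thesis by simp
qed

lemma F_u_bounds: "x \<in> F_u \<Longrightarrow> 0 \<le> x" "x \<in> F_u \<Longrightarrow> x \<le> 1"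
  and F_v_bounds: "y \<in> F_v \<Longrightarrow> 0 \<le> y" "y \<in> F_v \<Longrightarrow> y \<le> 1"
  using F_nonneg F_le_one by blast+

lemma zero_mem_u: "0 \<in> F_u"
proof -
  obtain x where x: "x \<in> F_u" using nonempty by blast
  have "a ^ n * x \<in> F_u" for n
    by (induction n) (use x map_a in \<open>auto simp: mult.assoc\<close>)
  moreover have "(\<lambda>n. a ^ n * x) \<longlonglongrightarrow> 0 * x"
    using pos less_one by (intro tendsto_intros LIMSEQ_power_zero) auto
  ultimately show ?thesis
    using closed_sequentially[OF compact_imp_closed[OF compact(1)]] by fastforce
qed

lemma zero_mem_v: "0 \<in> F_v"
proof -
  obtain x where x: "x \<in> F_v" using nonempty by blast
  have "c ^ n * x \<in> F_v" for n
    by (induction n) (use x map_c in \<open>auto simp: mult.assoc\<close>)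
  moreover have "(\<lambda>n. c ^ n * x) \<longlonglongrightarrow> 0 * x"
    using pos less_one by (intro tendsto_intros LIMSEQ_power_zero) auto
  ultimately show ?thesis
    using closed_sequentially[OF compact_imp_closed[OF compact(2)]] by fastforce
qed

text \<open>The composite of the two edges \<open>u \<rightarrow> v \<rightarrow> u\<close> is a similarity of ratio \<open>b d\<close> with fixed point \<open>1\<close>.\<close>

lemma map_bd_iterate: "x \<in> F_u \<Longrightarrow> 1 - (b * d) ^ n * (1 - x) \<in> F_u"
proof (induction n)
  case (Suc n)
  let ?y = "1 - (b * d) ^ n * (1 - x)"
  have "a + g_u + b * (c + g_v + d * ?y) \<in> F_u"
    using Suc by (intro map_b map_d) auto
  moreover have ends: "a + g_u = 1 - b" "c + g_v = 1 - d" using sum_u sum_v by auto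
  have "a + g_u + b * (c + g_v + d * ?y) = 1 - (b * d) ^ Suc n * (1 - x)"
    unfolding ends by (simp add: algebra_simps)
  ultimately show ?case by simp
qed auto

lemma one_mem_u: "1 \<in> F_u"
proof -
  have "b * d < 1 * 1" using pos less_one by (intro mult_strict_mono) auto
  hence "(\<lambda>n. 1 - (b * d) ^ n * (1 - 0)) \<longlonglongrightarrow> 1 - 0 * (1 - 0)"
    using pos by (intro tendsto_intros LIMSEQ_power_zero) auto
  thus ?thesis
    using closed_sequentially[OF compact_imp_closed[OF compact(1)]] map_bd_iterate[OF zero_mem_u]
    by fastforce
qed

lemma one_mem_v: "1 \<in> F_v"
  using map_d[OF one_mem_u] sum_v by simp

lemma powers_of_a_mem_u: "a ^ n \<in> F_u"
  by (induction n) (use one_mem_u map_a in auto)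

lemma powers_of_bd_near_one_u: "1 - b * (b * d) ^ n \<in> F_u"
proof -
  have "a + g_u = 1 - b" using sum_u by simp
  hence "1 - b \<in> F_u" using map_b[OF zero_mem_v] by simp
  from map_bd_iterate[OF this, of n] show ?thesis by (simp add: mult.commute)
qed

lemma powers_of_bd_near_one_v: "1 - (b * d) ^ Suc n \<in> F_v"
proof -
  have "c + g_v + d * (1 - b * (b * d) ^ n) \<in> F_v"
    by (rule map_d[OF powers_of_bd_near_one_u])
  also have "c + g_v + d * (1 - b * (b * d) ^ n) = 1 - (b * d) ^ Suc n"
    using sum_v by (simp add: algebra_simps)
  finally show ?thesis .
qed

section \<open>Gaps and one-sided isolation\<close>

lemma gap_u: assumes "a < x" "x < a + g_u" shows "x \<notin> F_u"
proof
  assume "x \<in> F_u"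
  then consider y where "y \<in> F_u" "x = a * y" | y where "y \<in> F_v" "x = a + g_u + b * y"
    using mem_u_iff[of x] by blast
  thus False
  proof cases
    case (1 y)
    thus ?thesis using F_u_bounds(2)[of y] pos assms by simp
  next
    case (2 y)
    thus ?thesis using mult_nonneg_nonneg[of b y] F_v_bounds(1)[of y] pos assms by linarith
  qed
qed

lemma right_piece_u: assumes "x \<in> F_u" "a < x" obtains y where "y \<in> F_v" "x = a + g_u + b * y"
proof -
  have "\<not> (\<exists>y\<in>F_u. x = a * y)" using F_u_bounds(2) pos assms by fastforce
  with assms(1) that show ?thesis using mem_u_iff[of x] by blast
qed

lemma scaled_gaps_v:
  assumes "c ^ Suc m < x" "x < c ^ m * (c + g_v)" shows "x \<notin> F_v"
  using assms
proof (induction m arbitrary: x)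
  case 0
  show ?case
  proof
    assume "x \<in> F_v"
    then consider y where "y \<in> F_v" "x = c * y" | y where "y \<in> F_u" "x = c + g_v + d * y"
      using mem_v_iff[of x] by blast
    thus False
    proof cases
      case (1 y)
      thus ?thesis using F_v_bounds(2)[of y] pos 0 by simp
    next
      case (2 y)
      hence "0 \<le> d * y" using F_u_bounds(1)[of y] pos by simp
      thus ?thesis using 2 0 by simp
    qed
  qed
next
  case (Suc m)
  show ?case
  proof
    assume "x \<in> F_v"
    then consider y where "y \<in> F_v" "x = c * y" | y where "y \<in> F_u" "x = c + g_v + d * y"
      using mem_v_iff[of x] by blast
    thus False
    proof cases
      case (1 y)
      hence "c ^ Suc m < y" "y < c ^ m * (c + g_v)" using Suc.prems pos by auto
      with Suc.IH 1 show ?thesis by blast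
    next
      case (2 y)
      have "x < c ^ Suc m * (c + g_v)" by (rule Suc.prems)
      also have "\<dots> \<le> 1 * (c + g_v)"
        using pos less_one by (intro mult_right_mono power_le_one) auto
      also have "\<dots> \<le> x" using 2 F_u_bounds(1)[of y] pos by simp
      finally show ?thesis by simp
    qed
  qed
qed

lemma no_geometric_sequence_right_of_gap:
  assumes "0 < t" "t < 1" "ln t / ln c \<notin> \<rat>" "0 < \<kappa>"
  shows "\<exists>n. a + g_u + \<kappa> * t ^ n \<notin> F_u"
proof (rule ccontr)
  assume "\<not> ?thesis"
  hence all: "a + g_u + \<kappa> * t ^ n \<in> F_u" for n by blast
  define \<mu> where "\<mu> = \<kappa> / b"
  have "\<mu> > 0" using assms pos by (simp add: \<mu>_def)
  have v: "\<mu> * t ^ n \<in> F_v" for n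
  proof -
    have "\<kappa> * t ^ n > 0" using assms by simp
    then obtain y where "y \<in> F_v" "a + g_u + \<kappa> * t ^ n = a + g_u + b * y"
      using right_piece_u[OF all[of n]] pos by auto
    thus ?thesis using pos by (simp add: \<mu>_def)
  qed
  have "\<mu> \<le> 1" using F_v_bounds(2)[OF v[of 0]] by simp
  obtain m n where "c ^ Suc m < \<mu> * t ^ n" "\<mu> * t ^ n < c ^ m * (c + g_v)"
    using geometric_sequence_hits_scaled_interval[of t c "c + g_v" \<mu>] assms pos sum_v
      \<open>\<mu> > 0\<close> \<open>\<mu> \<le> 1\<close> by auto
  with scaled_gaps_v v show False by blast
qed

definition max_ratio :: real where
  "max_ratio = max (max a b) (max c d)"

lemma max_ratio_bounds: "0 < max_ratio" "max_ratio < 1"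
  using pos less_one by (auto simp: max_ratio_def)

text \<open>
  Pulling a point back into a first-level piece divides the length of the empty interval next to it
  by the ratio of that piece, which is at most \<open>max_ratio\<close>. So after finitely many steps the interval
  is longer than \<open>[0, 1]\<close>, which is where the two inductions below start.
\<close>

lemma rescaled_length:
  assumes "k \<in> {a, b, c, d}" "max_ratio ^ Suc n < l" "0 \<le> l"
  shows "max_ratio ^ n < l / k" "l \<le> l / k"
proof -
  have k: "0 < k" "k \<le> max_ratio" "k \<le> 1"
    using assms(1) pos less_one by (auto simp: max_ratio_def)
  have "max_ratio ^ n * k \<le> max_ratio ^ n * max_ratio"
    using k max_ratio_bounds by (intro mult_left_mono) auto
  also have "\<dots> < l" using assms(2) by (simp add: mult.commute)
  finally show "max_ratio ^ n < l / k" using k by (simp add: less_divide_eq)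
  show "l \<le> l / k" using k assms(3) by (simp add: le_divide_eq mult_left_le)
qed

lemma max_ratio_power_less: assumes "0 < l" obtains n where "max_ratio ^ n < l"
  using real_arch_pow_inv[OF assms max_ratio_bounds(2)] by blast

text \<open>
  The point is followed down the tree of pieces. An interval longer than \<open>g\<^sub>u\<close> cannot end at
  \<open>a + g\<^sub>u\<close>, because \<open>a\<close> belongs to \<open>F\<^sub>u\<close>, so in a piece of type \<open>v\<close> the point is never the left
  endpoint \<open>0\<close>; this is the condition \<open>0 < x\<close> in the second part. The descent can therefore stop only
  at the left endpoint of a piece of type \<open>u\<close>.
\<close>

lemma left_isolated_aux:
  shows "max_ratio ^ n < l \<Longrightarrow> g_u < l \<Longrightarrow> x \<in> F_u \<Longrightarrow> F_u \<inter> {x - l<..<x} = {} \<Longrightarrow>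
           \<exists>\<kappa>>0. \<forall>k. x + \<kappa> * a ^ k \<in> F_u"
    and "max_ratio ^ n < l \<Longrightarrow> g_u < l \<Longrightarrow> x \<in> F_v \<Longrightarrow> 0 < x \<Longrightarrow> F_v \<inter> {x - l<..<x} = {} \<Longrightarrow>
           \<exists>\<kappa>>0. \<forall>k. x + \<kappa> * a ^ k \<in> F_v"
proof (induction n arbitrary: l x)
  case 0
  {
    case 1
    have "x - l < 0" using F_u_bounds(2)[of x] 1 by simp
    with 1 zero_mem_u F_u_bounds(1)[of x] have "x = 0" by fastforce
    thus ?case using powers_of_a_mem_u by (intro exI[of _ 1]) auto
  next
    case 2
    have "x - l < 0" using F_v_bounds(2)[of x] 2 by simp
    with 2 zero_mem_v have False by fastforce
    thus ?case ..
  }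
next
  case (Suc n)
  {
    case 1
    from \<open>x \<in> F_u\<close> consider (a) z where "z \<in> F_u" "x = a * z"
      | (b) z where "z \<in> F_v" "x = a + g_u + b * z"
      using mem_u_iff[of x] by blast
    thus ?case
    proof cases
      case a
      have len: "max_ratio ^ n < l / a" "g_u < l / a"
        using rescaled_length[of a n l] 1 pos by auto
      have "F_u \<inter> {z - l / a<..<z} = {}"
      proof -
        have "a * w \<in> F_u \<inter> {x - l<..<x}" if "w \<in> F_u" "z - l / a < w" "w < z" for w
          using that pos a map_a[of w] by (auto simp: field_simps)
        with 1 show ?thesis by fastforce
      qed
      then obtain \<kappa> where "\<kappa> > 0" and \<kappa>: "\<And>k. z + \<kappa> * a ^ k \<in> F_u"
        using Suc.IH(1)[OF len \<open>z \<in> F_u\<close>] by blast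
      have "x + a * \<kappa> * a ^ k \<in> F_u" for k
        using map_a[OF \<kappa>[of k]] a by (simp add: algebra_simps)
      thus ?thesis using \<open>\<kappa> > 0\<close> pos by (intro exI[of _ "a * \<kappa>"]) auto
    next
      case b
      have len: "max_ratio ^ n < l / b" "g_u < l / b"
        using rescaled_length[of b n l] 1 pos by auto
      have "z \<noteq> 0"
      proof
        assume "z = 0"
        hence "a \<in> F_u \<inter> {x - l<..<x}"
          using b 1 pos map_a[OF one_mem_u] by auto
        with 1 show False by blast
      qed
      hence "z > 0" using F_v_bounds(1)[of z] b by simp
      have "F_v \<inter> {z - l / b<..<z} = {}"
      proof -
        have "a + g_u + b * w \<in> F_u \<inter> {x - l<..<x}" if "w \<in> F_v" "z - l / b < w" "w < z" for w
          using that pos b map_b[of w] by (auto simp: field_simps)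
        with 1 show ?thesis by fastforce
      qed
      then obtain \<kappa> where "\<kappa> > 0" and \<kappa>: "\<And>k. z + \<kappa> * a ^ k \<in> F_v"
        using Suc.IH(2)[OF len \<open>z \<in> F_v\<close> \<open>z > 0\<close>] by blast
      have "x + b * \<kappa> * a ^ k \<in> F_u" for k
        using map_b[OF \<kappa>[of k]] b by (simp add: algebra_simps)
      thus ?thesis using \<open>\<kappa> > 0\<close> pos by (intro exI[of _ "b * \<kappa>"]) auto
    qed
  next
    case 2
    from \<open>x \<in> F_v\<close> consider (c) z where "z \<in> F_v" "x = c * z"
      | (d) z where "z \<in> F_u" "x = c + g_v + d * z"
      using mem_v_iff[of x] by blast
    thus ?case
    proof cases
      case c
      have len: "max_ratio ^ n < l / c" "g_u < l / c"
        using rescaled_length[of c n l] 2 pos by auto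
      have "z > 0" using c 2 pos by (simp add: zero_less_mult_iff)
      have "F_v \<inter> {z - l / c<..<z} = {}"
      proof -
        have "c * w \<in> F_v \<inter> {x - l<..<x}" if "w \<in> F_v" "z - l / c < w" "w < z" for w
          using that pos c map_c[of w] by (auto simp: field_simps)
        with 2 show ?thesis by fastforce
      qed
      then obtain \<kappa> where "\<kappa> > 0" and \<kappa>: "\<And>k. z + \<kappa> * a ^ k \<in> F_v"
        using Suc.IH(2)[OF len \<open>z \<in> F_v\<close> \<open>z > 0\<close>] by blast
      have "x + c * \<kappa> * a ^ k \<in> F_v" for k
        using map_c[OF \<kappa>[of k]] c by (simp add: algebra_simps)
      thus ?thesis using \<open>\<kappa> > 0\<close> pos by (intro exI[of _ "c * \<kappa>"]) auto
    next
      case d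
      have len: "max_ratio ^ n < l / d" "g_u < l / d"
        using rescaled_length[of d n l] 2 pos by auto
      have "F_u \<inter> {z - l / d<..<z} = {}"
      proof -
        have "c + g_v + d * w \<in> F_v \<inter> {x - l<..<x}" if "w \<in> F_u" "z - l / d < w" "w < z" for w
          using that pos d map_d[of w] by (auto simp: field_simps)
        with 2 show ?thesis by fastforce
      qed
      then obtain \<kappa> where "\<kappa> > 0" and \<kappa>: "\<And>k. z + \<kappa> * a ^ k \<in> F_u"
        using Suc.IH(1)[OF len \<open>z \<in> F_u\<close>] by blast
      have "x + d * \<kappa> * a ^ k \<in> F_v" for k
        using map_d[OF \<kappa>[of k]] d by (simp add: algebra_simps)
      thus ?thesis using \<open>\<kappa> > 0\<close> pos by (intro exI[of _ "d * \<kappa>"]) auto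
    qed
  }
qed

lemma left_isolated:
  assumes "x \<in> F_u" "g_u < l" "F_u \<inter> {x - l<..<x} = {}"
  shows "\<exists>\<kappa>>0. \<forall>k. x + \<kappa> * a ^ k \<in> F_u"
proof -
  obtain n where "max_ratio ^ n < l"
    using max_ratio_power_less[of l] assms(2) pos by auto
  thus ?thesis using left_isolated_aux(1) assms by blast
qed

text \<open>
  The same descent from the other side. At their common right endpoint \<open>1\<close> both \<open>F\<^sub>u\<close> and \<open>F\<^sub>v\<close>
  scale by \<open>b d\<close>, so the type of the piece at which the descent stops does not matter, and the empty
  interval may be arbitrarily short.
\<close>

lemma right_isolated_aux:
  shows "max_ratio ^ n < l \<Longrightarrow> x \<in> F_u \<Longrightarrow> F_u \<inter> {x<..<x + l} = {} \<Longrightarrow>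
           \<exists>\<kappa>>0. \<forall>k. x - \<kappa> * (b * d) ^ k \<in> F_u"
    and "max_ratio ^ n < l \<Longrightarrow> x \<in> F_v \<Longrightarrow> F_v \<inter> {x<..<x + l} = {} \<Longrightarrow>
           \<exists>\<kappa>>0. \<forall>k. x - \<kappa> * (b * d) ^ k \<in> F_v"
proof (induction n arbitrary: l x)
  case 0
  {
    case 1
    have "x + l > 1" using F_u_bounds(1)[of x] 1 by simp
    with 1 one_mem_u F_u_bounds(2)[of x] have "x = 1" by fastforce
    thus ?case using powers_of_bd_near_one_u pos by (intro exI[of _ b]) auto
  next
    case 2
    have "x + l > 1" using F_v_bounds(1)[of x] 2 by simp
    with 2 one_mem_v F_v_bounds(2)[of x] have "x = 1" by fastforce
    thus ?case using powers_of_bd_near_one_v pos by (intro exI[of _ "b * d"]) auto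
  }
next
  case (Suc n)
  have l0: "0 \<le> l" if "max_ratio ^ Suc n < l" for l
    using that zero_less_power[OF max_ratio_bounds(1), of "Suc n"] by linarith
  {
    case 1
    from \<open>x \<in> F_u\<close> consider (a) z where "z \<in> F_u" "x = a * z"
      | (b) z where "z \<in> F_v" "x = a + g_u + b * z"
      using mem_u_iff[of x] by blast
    thus ?case
    proof cases
      case a
      have len: "max_ratio ^ n < l / a" using rescaled_length[of a n l] 1 l0 by auto
      have "F_u \<inter> {z<..<z + l / a} = {}"
      proof -
        have "a * w \<in> F_u \<inter> {x<..<x + l}" if "w \<in> F_u" "w < z + l / a" "z < w" for w
          using that pos a map_a[of w] by (auto simp: field_simps)
        with 1 show ?thesis by fastforce
      qed
      then obtain \<kappa> where "\<kappa> > 0" and \<kappa>: "\<And>k. z - \<kappa> * (b * d) ^ k \<in> F_u"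
        using Suc.IH(1)[OF len \<open>z \<in> F_u\<close>] by blast
      have "x - a * \<kappa> * (b * d) ^ k \<in> F_u" for k
        using map_a[OF \<kappa>[of k]] a by (simp add: algebra_simps)
      thus ?thesis using \<open>\<kappa> > 0\<close> pos by (intro exI[of _ "a * \<kappa>"]) auto
    next
      case b
      have len: "max_ratio ^ n < l / b" using rescaled_length[of b n l] 1 l0 by auto
      have "F_v \<inter> {z<..<z + l / b} = {}"
      proof -
        have "a + g_u + b * w \<in> F_u \<inter> {x<..<x + l}" if "w \<in> F_v" "w < z + l / b" "z < w" for w
          using that pos b map_b[of w] by (auto simp: field_simps)
        with 1 show ?thesis by fastforce
      qed
      then obtain \<kappa> where "\<kappa> > 0" and \<kappa>: "\<And>k. z - \<kappa> * (b * d) ^ k \<in> F_v"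
        using Suc.IH(2)[OF len \<open>z \<in> F_v\<close>] by blast
      have "x - b * \<kappa> * (b * d) ^ k \<in> F_u" for k
        using map_b[OF \<kappa>[of k]] b by (simp add: algebra_simps)
      thus ?thesis using \<open>\<kappa> > 0\<close> pos by (intro exI[of _ "b * \<kappa>"]) auto
    qed
  next
    case 2
    from \<open>x \<in> F_v\<close> consider (c) z where "z \<in> F_v" "x = c * z"
      | (d) z where "z \<in> F_u" "x = c + g_v + d * z"
      using mem_v_iff[of x] by blast
    thus ?case
    proof cases
      case c
      have len: "max_ratio ^ n < l / c" using rescaled_length[of c n l] 2 l0 by auto
      have "F_v \<inter> {z<..<z + l / c} = {}"
      proof -
        have "c * w \<in> F_v \<inter> {x<..<x + l}" if "w \<in> F_v" "w < z + l / c" "z < w" for w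
          using that pos c map_c[of w] by (auto simp: field_simps)
        with 2 show ?thesis by fastforce
      qed
      then obtain \<kappa> where "\<kappa> > 0" and \<kappa>: "\<And>k. z - \<kappa> * (b * d) ^ k \<in> F_v"
        using Suc.IH(2)[OF len \<open>z \<in> F_v\<close>] by blast
      have "x - c * \<kappa> * (b * d) ^ k \<in> F_v" for k
        using map_c[OF \<kappa>[of k]] c by (simp add: algebra_simps)
      thus ?thesis using \<open>\<kappa> > 0\<close> pos by (intro exI[of _ "c * \<kappa>"]) auto
    next
      case d
      have len: "max_ratio ^ n < l / d" using rescaled_length[of d n l] 2 l0 by auto
      have "F_u \<inter> {z<..<z + l / d} = {}"
      proof -
        have "c + g_v + d * w \<in> F_v \<inter> {x<..<x + l}" if "w \<in> F_u" "w < z + l / d" "z < w" for w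
          using that pos d map_d[of w] by (auto simp: field_simps)
        with 2 show ?thesis by fastforce
      qed
      then obtain \<kappa> where "\<kappa> > 0" and \<kappa>: "\<And>k. z - \<kappa> * (b * d) ^ k \<in> F_u"
        using Suc.IH(1)[OF len \<open>z \<in> F_u\<close>] by blast
      have "x - d * \<kappa> * (b * d) ^ k \<in> F_v" for k
        using map_d[OF \<kappa>[of k]] d by (simp add: algebra_simps)
      thus ?thesis using \<open>\<kappa> > 0\<close> pos by (intro exI[of _ "d * \<kappa>"]) auto
    qed
  }
qed

lemma right_isolated:
  assumes "x \<in> F_u" "0 < l" "F_u \<inter> {x<..<x + l} = {}"
  shows "\<exists>\<kappa>>0. \<forall>k. x - \<kappa> * (b * d) ^ k \<in> F_u"
proof -
  obtain n where "max_ratio ^ n < l" using max_ratio_power_less[OF assms(2)] by blast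
  thus ?thesis using right_isolated_aux(1) assms by blast
qed

section \<open>Contracting self-embeddings miss the right endpoint of the first gap\<close>

lemma gap_endpoint_not_in_image:
  assumes S: "contracting_similarity S" "S ` F_u \<subseteq> F_u"
    and irr: "ln a / ln c \<notin> \<rat>" "ln (b * d) / ln c \<notin> \<rat>"
  shows "a + g_u \<notin> S ` F_u"
proof
  assume "a + g_u \<in> S ` F_u"
  then obtain x where x: "x \<in> F_u" and Sx: "S x = a + g_u" by auto
  obtain r \<epsilon> where r: "0 < r" "r < 1" and \<epsilon>: "\<epsilon> = 1 \<or> \<epsilon> = - 1"
    and affine: "\<And>x y. S y = S x + \<epsilon> * r * (y - x)"
    using contracting_similarity_affine[OF S(1)] by metis
  have S_eq: "S y = a + g_u + \<epsilon> * r * (y - x)" for y using affine[of y x] Sx by simp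
  have S_mem: "a + g_u + \<epsilon> * r * (y - x) \<in> F_u" if "y \<in> F_u" for y
    using S(2) that S_eq by auto
  have len: "g_u < g_u / r" using r pos by (simp add: less_divide_eq)
  from \<epsilon> show False
  proof
    assume [simp]: "\<epsilon> = 1"
    have "F_u \<inter> {x - g_u / r<..<x} = {}"
    proof -
      have "y \<notin> F_u" if "x - g_u / r < y" "y < x" for y
      proof -
        have "r * (y - x) < 0" using that r by (simp add: mult_pos_neg)
        moreover have "- g_u < r * (y - x)" using that r by (simp add: field_simps)
        ultimately have "a + g_u + r * (y - x) \<notin> F_u" by (intro gap_u) linarith+
        thus ?thesis using S_mem by fastforce
      qed
      thus ?thesis by auto
    qed
    then obtain \<kappa> where "\<kappa> > 0" and \<kappa>: "\<And>k. x + \<kappa> * a ^ k \<in> F_u"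
      using left_isolated[OF x len] by blast
    have "a + g_u + r * \<kappa> * a ^ k \<in> F_u" for k
      using S_mem[OF \<kappa>[of k]] by (simp add: algebra_simps)
    thus False
      using no_geometric_sequence_right_of_gap[of a "r * \<kappa>"] irr r pos less_one \<open>\<kappa> > 0\<close> by auto
  next
    assume [simp]: "\<epsilon> = - 1"
    have "F_u \<inter> {x<..<x + g_u / r} = {}"
    proof -
      have "y \<notin> F_u" if "y < x + g_u / r" "x < y" for y
      proof -
        have "0 < r * (y - x)" using that r by simp
        moreover have "r * (y - x) < g_u" using that r by (simp add: field_simps)
        ultimately have "a + g_u - r * (y - x) \<notin> F_u" by (intro gap_u) linarith+
        thus ?thesis using S_mem by fastforce
      qed
      thus ?thesis by auto
    qed
    moreover have "0 < g_u / r" using r pos by simp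
    ultimately obtain \<kappa> where "\<kappa> > 0" and \<kappa>: "\<And>k. x - \<kappa> * (b * d) ^ k \<in> F_u"
      using right_isolated[OF x] by blast
    have "a + g_u + r * \<kappa> * (b * d) ^ k \<in> F_u" for k
      using S_mem[OF \<kappa>[of k]] by (simp add: algebra_simps)
    moreover have "b * d < 1 * 1" using pos less_one by (intro mult_strict_mono) auto
    ultimately show False
      using no_geometric_sequence_right_of_gap[of "b * d" "r * \<kappa>"] irr r pos \<open>\<kappa> > 0\<close> by auto
  qed
qed

end

section \<open>Multiplicative independence and the theorem\<close>

lemma mult_rat_indep_imp_irrational:
  assumes indep: "mult_rat_indep [g_u, g_v, a, b, c, d]" and "c < 1"
  shows "ln a / ln c \<notin> \<rat>" "ln (b * d) / ln c \<notin> \<rat>"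
proof -
  have pos: "a > 0" "b > 0" "c > 0" "d > 0"
    using indep by (auto simp: mult_rat_indep_def)
  have exponents: "k = 0 \<and> l = 0"
    if "a powi k * b powi l * c powi m * d powi l = 1" for k l m :: int
  proof -
    let ?e = "\<lambda>i::nat. [0, 0, k, l, m, l] ! i"
    have "(\<Prod>i<length [g_u, g_v, a, b, c, d]. [g_u, g_v, a, b, c, d] ! i powi ?e i) = 1"
      using that by (simp add: numeral_eq_Suc lessThan_Suc mult_ac)
    hence "\<forall>i<6. ?e i = 0"
      using indep unfolding mult_rat_indep_def by (auto simp: numeral_eq_Suc)
    from this[rule_format, of 2] this[rule_format, of 3] show ?thesis by simp
  qed
  show "ln a / ln c \<notin> \<rat>"
  proof
    assume "ln a / ln c \<in> \<rat>"
    then obtain p q :: int where "q \<noteq> 0" "a powi q = c powi p"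
      using rational_ln_ratio_imp_powi_eq[of a c] pos \<open>c < 1\<close> by auto
    hence "a powi q * c powi (- p) = 1" using pos by (simp add: power_int_minus)
    with exponents[of q 0 "- p"] \<open>q \<noteq> 0\<close> show False by simp
  qed
  show "ln (b * d) / ln c \<notin> \<rat>"
  proof
    assume "ln (b * d) / ln c \<in> \<rat>"
    then obtain p q :: int where "q \<noteq> 0" "(b * d) powi q = c powi p"
      using rational_ln_ratio_imp_powi_eq[of "b * d" c] pos \<open>c < 1\<close> by auto
    hence "b powi q * d powi q = c powi p" by (simp add: power_int_mult_distrib)
    hence "b powi q * c powi (- p) * d powi q = 1"
      using pos by (simp add: power_int_minus field_simps)
    with exponents[of 0 q "- p"] \<open>q \<noteq> 0\<close> show False by simp
  qed
qed

theorem theorem7p4: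
  fixes a g_u b c g_v d s :: real
    and I_u I_v F_u F_v :: "real set"
    and h_u h_v :: ennreal
  assumes "a > 0" "g_u > 0" "b > 0" "c > 0" "g_v > 0" "d > 0"
    and "a + g_u + b = 1" and "c + g_v + d = 1"
    and "I_u = {0..1}" and "I_v = {0..1}"
    and "two_vertex_attractors a g_u b c g_v d F_u F_v"
    and "s = hausdorff_dim F_u" and "s = hausdorff_dim F_v"
    and "h_u = hausdorff_measure s F_u" and "h_v = hausdorff_measure s F_v"
    and "diameter I_u = diameter I_v"
    and "h_v / h_u \<le> 1"
    and "(a + g_u) * (1 - a powr s) / (b * a powr s) \<ge> 1"
    and "mult_rat_indep [g_u, g_v, a, b, c, d]"
  shows "\<not> (\<exists>n S. standard_ifs n S \<and> ifs_attractor n S F_u)"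
proof
  assume "\<exists>n S. standard_ifs n S \<and> ifs_attractor n S F_u"
  then obtain n :: nat and S where sim: "\<And>i. i < n \<Longrightarrow> contracting_similarity (S i)"
    and F: "F_u = (\<Union>i<n. S i ` F_u)"
    unfolding standard_ifs_def ifs_attractor_def by blast
  interpret two_vertex_system a g_u b c g_v d F_u F_v
    using assms by unfold_locales auto
  have "a + g_u \<in> F_u" using map_b[OF zero_mem_v] by simp
  then obtain i where i: "i < n" "a + g_u \<in> S i ` F_u" using F by blast
  hence "S i ` F_u \<subseteq> F_u" using F by blast
  with gap_endpoint_not_in_image[OF sim[OF i(1)]] i(2) show False
    using mult_rat_indep_imp_irrational[OF \<open>mult_rat_indep [g_u, g_v, a, b, c, d]\<close> less_one(3)]
    by blast
qed

end
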